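(* Let $n\ge 3$. The viewing graph variety $\mathcal{V}_{K_n}$ of the complete graph $K_n$ is a proper subset of the variety in $(\mathbb{P}^{3\times 3})^{\binom n2}$ consisting of tuples $(F^{ij})_{1\le i<j\le n}$ of matrices of rank at most $2$ satisfying the $3\binom n3$ triple-wise constraints $$(e_i^k)^TF^{ij}e_j^k=0\quad\text{for all distinct } i,j,k \text{ with } i<j,$$ and the $\binom n4$ quadruple-wise constraints: for all $a<b<c<d$, $$\mathbf{e}_{dabc}\,\mathbf{e}_{bacd}\,\mathbf{e}_{cadb}\,\mathbf{e}_{dbca}\,\mathbf{e}_{abdc}\,\mathbf{e}_{bcda}=\mathbf{e}_{cabd}\,\mathbf{e}_{dacb}\,\mathbf{e}_{badc}\,\mathbf{e}_{abcd}\,\mathbf{e}_{cbda}\,\mathbf{e}_{acdb},$$ where $\mathbf{e}_{sijt}:=(e_i^s)^TF^{ij}e_j^t$.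
   Context: Everything is over $\mathbb{R}$; $\mathbb{P}^{m\times k}$ denotes the projective space of nonzero real $m\times k$ matrices up to scale. For $3\times 4$ matrices $P_1,P_2$, $\psi(P_1,P_2)$ is the $3\times3$ matrix $F$ (up to scale) with $\det\begin{bmatrix}P_1&x&0\\P_2&0&y\end{bmatrix}=x^TFy$ for all $x,y\in\mathbb{R}^3$; it is a rational map $\mathbb{P}^{3\times4}\times\mathbb{P}^{3\times4}\dashrightarrow\mathbb{P}^{3\times3}$, undefined exactly when $\ker P_1\cap\ker P_2\ne\{0\}$. The fundamental map of $K_n$ is the rational map $\Psi_{K_n}:(\mathbb{P}^{3\times4})^n\dashrightarrow(\mathbb{P}^{3\times3})^{\binom n2}$, $(P_1,\dots,P_n)\mapsto(\psi(P_i,P_j))_{i<j}$, and the viewing graph variety $\mathcal{V}_{K_n}$ is the Zariski closure of its image. Put $F^{ji}=(F^{ij})^T$. The epipole $e_j^i$ is a vector spanning $\ker F^{ij}$ if $F^{ij}$ has rank 2, and is the zero vector if $F^{ij}$ has rank 1. (The constraints do not depend on the choice of scale of the $F^{ij}$ and of the spanning vectors.) *)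

theory Defs
  imports "HOL-Analysis.Analysis"
begin

section \<open>Projective spaces of matrices\<close>

definition proportional :: "real^'k^'m \<Rightarrow> real^'k^'m \<Rightarrow> bool" where
  "proportional A B \<longleftrightarrow> A \<noteq> 0 \<and> B \<noteq> 0 \<and> (\<exists>c. A = c *\<^sub>R B)"

text \<open>\<open>('m, 'k) proj_mat\<close> is the projective space of nonzero real matrices with row index type
  \<open>'m\<close> and column index type \<open>'k\<close>; \<open>abs_proj_mat\<close> is the class map (meaningful on nonzero
  matrices only), and \<open>rep_proj_mat\<close> picks a nonzero representative.\<close>

quotient_type ('m, 'k) proj_mat = "real^'k::finite^'m::finite" / partial: proportional
proof (rule part_equivpI)
  have "(\<chi> i. \<chi> j. 1) \<noteq> (0 :: real^'k^'m)"
    by (simp add: vec_eq_iff)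
  moreover have "A = 1 *\<^sub>R A" for A :: "real^'k^'m" by simp
  ultimately show "\<exists>A::real^'k^'m. proportional A A"
    unfolding proportional_def by blast
  show "symp (proportional :: real^'k^'m \<Rightarrow> _)"
  proof (rule sympI)
    fix A B :: "real^'k^'m"
    assume "proportional A B"
    then obtain c where c: "A \<noteq> 0" "B \<noteq> 0" "A = c *\<^sub>R B"
      unfolding proportional_def by blast
    then have "B = (1 / c) *\<^sub>R A" by auto
    with c show "proportional B A" unfolding proportional_def by blast
  qed
  show "transp (proportional :: real^'k^'m \<Rightarrow> _)"
  proof (rule transpI)
    fix A B C :: "real^'k^'m"
    assume "proportional A B" "proportional B C"
    then obtain c d where "A \<noteq> 0" "C \<noteq> 0" "A = c *\<^sub>R B" "B = d *\<^sub>R C"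
      unfolding proportional_def by blast
    moreover from this have "A = (c * d) *\<^sub>R C" by simp
    ultimately show "proportional A C" unfolding proportional_def by blast
  qed
qed

section \<open>Zariski topology on finite products of projective spaces\<close>

inductive poly_fun :: "'e set \<Rightarrow> (('e \<Rightarrow> real^'k^'m) \<Rightarrow> real) \<Rightarrow> bool" for E :: "'e set" where
  const: "poly_fun E (\<lambda>M. c)"
| coord: "e \<in> E \<Longrightarrow> poly_fun E (\<lambda>M. M e $ i $ j)"
| add: "poly_fun E p \<Longrightarrow> poly_fun E q \<Longrightarrow> poly_fun E (\<lambda>M. p M + q M)"
| mult: "poly_fun E p \<Longrightarrow> poly_fun E q \<Longrightarrow> poly_fun E (\<lambda>M. p M * q M)"

text \<open>Since the reals are infinite, a polynomial is determined by its function, and it is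
  homogeneous of degree \<open>d e\<close> in the \<open>e\<close>-th block of variables iff its function scales accordingly.\<close>

definition multihomogeneous :: "'e set \<Rightarrow> (('e \<Rightarrow> real^'k^'m) \<Rightarrow> real) \<Rightarrow> bool" where
  "multihomogeneous E p \<longleftrightarrow>
     (\<exists>d :: 'e \<Rightarrow> nat. \<forall>e\<in>E. \<forall>c M. p (M(e := c *\<^sub>R M e)) = c ^ d e * p M)"

text \<open>Points of the product over \<open>E\<close> are extensional functions. By multihomogeneity the choice of
  representatives does not affect vanishing.\<close>

definition zariski_closed :: "'e set \<Rightarrow> ('e \<Rightarrow> ('m::finite, 'k::finite) proj_mat) set \<Rightarrow> bool" where
  "zariski_closed E Z \<longleftrightarrow>
     (\<exists>S. (\<forall>p\<in>S. poly_fun E p \<and> multihomogeneous E p) \<and>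
          Z = {x \<in> E \<rightarrow>\<^sub>E UNIV. \<forall>p\<in>S. p (\<lambda>e. rep_proj_mat (x e)) = 0})"

definition zariski_closure ::
  "'e set \<Rightarrow> ('e \<Rightarrow> ('m::finite, 'k::finite) proj_mat) set \<Rightarrow> ('e \<Rightarrow> ('m, 'k) proj_mat) set" where
  "zariski_closure E A = \<Inter>{Z. zariski_closed E Z \<and> A \<subseteq> Z}"

section \<open>The viewing graph variety of the complete graph\<close>

text \<open>The \<open>6 \<times> 6\<close> block matrix with rows \<open>(P x 0)\<close> and \<open>(Q 0 y)\<close>.
  In a numeral index type \<open>k\<close>, the last index \<open>k\<close> is the element \<open>0\<close>.\<close>

definition block_matrix ::
  "real^4^3 \<Rightarrow> real^4^3 \<Rightarrow> real^3 \<Rightarrow> real^3 \<Rightarrow> real^6^6" where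
  "block_matrix P Q x y = vector
    [vector [P$1$1, P$1$2, P$1$3, P$1$4, x$1, 0],
     vector [P$2$1, P$2$2, P$2$3, P$2$4, x$2, 0],
     vector [P$3$1, P$3$2, P$3$3, P$3$4, x$3, 0],
     vector [Q$1$1, Q$1$2, Q$1$3, Q$1$4, 0, y$1],
     vector [Q$2$1, Q$2$2, Q$2$3, Q$2$4, 0, y$2],
     vector [Q$3$1, Q$3$2, Q$3$3, Q$3$4, 0, y$3]]"

definition psi :: "real^4^3 \<Rightarrow> real^4^3 \<Rightarrow> real^3^3" where
  "psi P Q = (THE F. \<forall>x y. det (block_matrix P Q x y) = x \<bullet> (F *v y))"

definition edges :: "nat \<Rightarrow> (nat \<times> nat) set" where
  "edges n = {(i, j). 1 \<le> i \<and> i < j \<and> j \<le> n}"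

text \<open>The entries of \<open>psi\<close> are bihomogeneous, so the map on projective spaces is defined where
  \<open>psi\<close> does not vanish. This forces the two kernels to intersect trivially; for matrices of
  rank at least two it is equivalent to that.\<close>

definition fundamental_map_dom :: "nat \<Rightarrow> (nat \<Rightarrow> (3, 4) proj_mat) set" where
  "fundamental_map_dom n =
     {P \<in> {1..n} \<rightarrow>\<^sub>E UNIV.
        \<forall>(i, j)\<in>edges n. psi (rep_proj_mat (P i)) (rep_proj_mat (P j)) \<noteq> 0}"

definition fundamental_map :: "nat \<Rightarrow> (nat \<Rightarrow> (3, 4) proj_mat) \<Rightarrow> (nat \<times> nat \<Rightarrow> (3, 3) proj_mat)" where
  "fundamental_map n P =
     (\<lambda>(i, j)\<in>edges n. abs_proj_mat (psi (rep_proj_mat (P i)) (rep_proj_mat (P j))))"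

definition viewing_graph_variety :: "nat \<Rightarrow> (nat \<times> nat \<Rightarrow> (3, 3) proj_mat) set" where
  "viewing_graph_variety n = zariski_closure (edges n) (fundamental_map n ` fundamental_map_dom n)"

section \<open>Epipoles and the triple-wise and quadruple-wise constraints\<close>

definition fmat :: "(nat \<times> nat \<Rightarrow> (3, 3) proj_mat) \<Rightarrow> nat \<Rightarrow> nat \<Rightarrow> real^3^3" where
  "fmat x i j = (if i < j then rep_proj_mat (x (i, j)) else transpose (rep_proj_mat (x (j, i))))"

text \<open>\<open>epipole x i j\<close> is $e_j^i$: the upper index comes first. It is only used for matrices of
  rank one or two.\<close>

definition epipole :: "(nat \<times> nat \<Rightarrow> (3, 3) proj_mat) \<Rightarrow> nat \<Rightarrow> nat \<Rightarrow> real^3" where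
  "epipole x i j =
     (if rank (fmat x i j) = 2 then SOME v. span {v} = {u. fmat x i j *v u = 0} else 0)"

text \<open>\<open>epi_form x s i j t\<close> is $\mathbf{e}_{sijt} = (e_i^s)^T F^{ij} e_j^t$.\<close>

definition epi_form ::
  "(nat \<times> nat \<Rightarrow> (3, 3) proj_mat) \<Rightarrow> nat \<Rightarrow> nat \<Rightarrow> nat \<Rightarrow> nat \<Rightarrow> real" where
  "epi_form x s i j t = epipole x s i \<bullet> (fmat x i j *v epipole x t j)"

definition triple_constraints :: "nat \<Rightarrow> (nat \<times> nat \<Rightarrow> (3, 3) proj_mat) \<Rightarrow> bool" where
  "triple_constraints n x \<longleftrightarrow>
     (\<forall>i\<in>{1..n}. \<forall>j\<in>{1..n}. \<forall>k\<in>{1..n}. i < j \<and> k \<noteq> i \<and> k \<noteq> j \<longrightarrow> epi_form x k i j k = 0)"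

definition quadruple_constraints :: "nat \<Rightarrow> (nat \<times> nat \<Rightarrow> (3, 3) proj_mat) \<Rightarrow> bool" where
  "quadruple_constraints n x \<longleftrightarrow>
     (\<forall>a\<in>{1..n}. \<forall>b\<in>{1..n}. \<forall>c\<in>{1..n}. \<forall>d\<in>{1..n}. a < b \<and> b < c \<and> c < d \<longrightarrow>
        epi_form x d a b c * epi_form x b a c d * epi_form x c a d b *
        epi_form x d b c a * epi_form x a b d c * epi_form x b c d a =
        epi_form x c a b d * epi_form x d a c b * epi_form x b a d c *
        epi_form x a b c d * epi_form x c b d a * epi_form x a c d b)"

definition constraint_variety :: "nat \<Rightarrow> (nat \<times> nat \<Rightarrow> (3, 3) proj_mat) set" where
  "constraint_variety n =
     {x \<in> edges n \<rightarrow>\<^sub>E UNIV.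
        (\<forall>(i, j)\<in>edges n. rank (fmat x i j) \<le> 2) \<and>
        triple_constraints n x \<and> quadruple_constraints n x}"

end

theory Submission
  imports Defs
begin

text \<open>Let \<open>c_i\<close> be the vector of signed maximal minors of the camera \<open>P_i\<close>. Every entry of
  \<open>F = psi P_i P_j\<close> is a \<open>4 \<times> 4\<close> determinant of two rows of \<open>P_i\<close> and two rows of \<open>P_j\<close>, so the
  Pluecker relations give, without any rank assumption, \<open>F (P_j v) = (P_i v) \<times> (P_i c_j)\<close> and the
  cofactor matrix \<open>- (P_i c_j) (P_j c_i)\<^sup>T\<close> of \<open>F\<close>. For any \<open>F\<close> of rank at most two the cofactors
  span the kernel or all vanish, exactly like the epipole; hence the constraints are polynomial, and
  on the image of the fundamental map \<open>e_sijt\<close> is a scalar times \<open>det [c_s, c_t, c_j, c_i]\<close>. The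
  constraints then reduce to the alternation of the determinant.

  For properness, \<open>F\<^sup>1\<^sup>2 e_2\<^sup>3\<close> and \<open>F\<^sup>1\<^sup>3 e_3\<^sup>2\<close> are parallel on the image, both being the line through
  the epipoles \<open>e_1\<^sup>2\<close> and \<open>e_1\<^sup>3\<close>. When all matrices but \<open>F\<^sup>2\<^sup>3\<close> have rank one, all the constraints hold
  trivially, but this condition may fail.\<close>

unbundle cross3_syntax

section \<open>The fundamental matrix of two cameras\<close>

text \<open>The determinant with rows \<open>a, b, c, d\<close>, by Laplace expansion along the first two rows.\<close>

definition det4 :: "real^4 \<Rightarrow> real^4 \<Rightarrow> real^4 \<Rightarrow> real^4 \<Rightarrow> real" where
  "det4 a b c d =
     (a$1 * b$2 - a$2 * b$1) * (c$3 * d$4 - c$4 * d$3)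
   - (a$1 * b$3 - a$3 * b$1) * (c$2 * d$4 - c$4 * d$2)
   + (a$1 * b$4 - a$4 * b$1) * (c$2 * d$3 - c$3 * d$2)
   + (a$2 * b$3 - a$3 * b$2) * (c$1 * d$4 - c$4 * d$1)
   - (a$2 * b$4 - a$4 * b$2) * (c$1 * d$3 - c$3 * d$1)
   + (a$3 * b$4 - a$4 * b$3) * (c$1 * d$2 - c$2 * d$1)"

text \<open>A permutation that moves some \<open>x\<close> outside \<open>S\<close> picks an
  off-diagonal entry of column \<open>x\<close>, which is zero. Only the permutations of
  \<open>S\<close> survive, and on them the factors outside \<open>S\<close> are 1.\<close>

lemma det_eq_sum_permutes:
  fixes A :: "real^'n^'n"
  assumes "\<And>i. i \<notin> S \<Longrightarrow> column i A = axis i 1"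
  shows "det A = (\<Sum>p | p permutes S. of_int (sign p) * (\<Prod>i\<in>S. A $ i $ p i))"
proof -
  have A: "A $ j $ i = (if j = i then 1 else 0)" if "i \<notin> S" for i j
    using assms[OF that] by (auto simp: column_def vec_eq_iff axis_def)
  have "det A = (\<Sum>p | p permutes UNIV. of_int (sign p) * (\<Prod>i\<in>UNIV. A $ i $ p i))"
    by (simp add: det_def)
  also have "\<dots> = (\<Sum>p | p permutes S. of_int (sign p) * (\<Prod>i\<in>UNIV. A $ i $ p i))"
  proof (rule sum.mono_neutral_right)
    show "finite {p. p permutes (UNIV :: 'n set)}" by simp
    show "{p. p permutes S} \<subseteq> {p. p permutes UNIV}"
      using permutes_subset by blast
    show "\<forall>p\<in>{p. p permutes UNIV} - {p. p permutes S}.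
            real_of_int (sign p) * (\<Prod>i\<in>UNIV. A $ i $ p i) = 0"
    proof
      fix p assume p: "p \<in> {p. p permutes (UNIV :: 'n set)} - {p. p permutes S}"
      then obtain x where x: "x \<notin> S" "p x \<noteq> x"
        by (auto simp: permutes_def)
      obtain y where y: "p y = x" using p by (metis DiffD1 mem_Collect_eq permutes_def)
      then have "A $ y $ p y = 0" using A[OF x(1)] x(2) by auto
      then show "real_of_int (sign p) * (\<Prod>i\<in>UNIV. A $ i $ p i) = 0" by auto
    qed
  qed
  also have "\<dots> = (\<Sum>p | p permutes S. of_int (sign p) * (\<Prod>i\<in>S. A $ i $ p i))"
  proof (rule sum.cong[OF refl])
    fix p assume "p \<in> {p. p permutes S}"
    then have "A $ i $ p i = 1" if "i \<notin> S" for i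
      using A[OF that] that by (auto simp: permutes_def)
    then have "(\<Prod>i\<in>UNIV. A $ i $ p i) = (\<Prod>i\<in>S. A $ i $ p i)"
      by (intro prod.mono_neutral_right) auto
    then show "real_of_int (sign p) * (\<Prod>i\<in>UNIV. A $ i $ p i) =
        real_of_int (sign p) * (\<Prod>i\<in>S. A $ i $ p i)" by simp
  qed
  finally show ?thesis .
qed

text \<open>Spans the kernel of \<open>P\<close>, hence is the camera centre, when \<open>P\<close>
  has rank 3; it is zero for lower rank.\<close>

definition center :: "real^4^3 \<Rightarrow> real^4" where
  "center P = (\<chi> k. det4 (P$1) (P$2) (P$3) (axis k 1))"

text \<open>Index arithmetic in type \<open>3\<close> is cyclic, so no signs are needed here and in \<open>psi_eq\<close>.\<close>

definition cof3 :: "real^3^3 \<Rightarrow> real^3^3" where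
  "cof3 F = (\<chi> a. (F $ (a + 1)) \<times> (F $ (a + 2)))"

section \<open>The block determinant as a bilinear form\<close>

lemma numeral_mod_3: "(0::3) = 3" "(4::3) = 1" "(5::3) = 2"
  by simp_all

lemma vector_6:
 "(vector [x,y,z,u,v,w] ::('a::zero)^6)$1 = x"
 "(vector [x,y,z,u,v,w] ::('a::zero)^6)$2 = y"
 "(vector [x,y,z,u,v,w] ::('a::zero)^6)$3 = z"
 "(vector [x,y,z,u,v,w] ::('a::zero)^6)$4 = u"
 "(vector [x,y,z,u,v,w] ::('a::zero)^6)$5 = v"
 "(vector [x,y,z,u,v,w] ::('a::zero)^6)$6 = w"
  unfolding vector_def by simp_all

lemma exhaust_6:
  fixes x :: 6
  shows "x = 1 \<or> x = 2 \<or> x = 3 \<or> x = 4 \<or> x = 5 \<or> x = 6"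
proof (induct x)
  case (of_int z)
  then have "z = 0 \<or> z = 1 \<or> z = 2 \<or> z = 3 \<or> z = 4 \<or> z = 5" by fastforce
  then show ?case by auto
qed

lemma forall_6: "(\<forall>i::6. P i) \<longleftrightarrow> P 1 \<and> P 2 \<and> P 3 \<and> P 4 \<and> P 5 \<and> P 6"
  by (metis exhaust_6)

text \<open>The rotation of the first three rows is a 3-cycle, hence even. With the analogous
  rotation of the last three rows it reduces all nine entries of the bilinear form to a single
  one.\<close>

lemma det_block_matrix_rotate_left:
  "det (block_matrix (\<chi> i. P $ (i + 1)) Q (\<chi> i. x $ (i + 1)) y) = det (block_matrix P Q x y)"
proof -
  let ?p = "Transposition.transpose 1 2 \<circ> Transposition.transpose 2 (3::6)"
  have "block_matrix (\<chi> i. P $ (i + 1)) Q (\<chi> i. x $ (i + 1)) y = (\<chi> i. block_matrix P Q x y $ ?p i)"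
    unfolding vec_eq_iff forall_6
    by (simp add: block_matrix_def vector_6 numeral_mod_3 Transposition.transpose_def del: One_nat_def)
  moreover have "?p permutes UNIV"
    by (simp add: permutes_compose permutes_swap_id)
  moreover have "sign ?p = 1"
    by (simp add: sign_compose permutation_swap_id sign_swap_id)
  ultimately show ?thesis
    by (simp add: det_permute_rows del: comp_apply)
qed

lemma det_block_matrix_rotate_right:
  "det (block_matrix P (\<chi> i. Q $ (i + 1)) x (\<chi> i. y $ (i + 1))) = det (block_matrix P Q x y)"
proof -
  let ?p = "Transposition.transpose 4 5 \<circ> Transposition.transpose 5 (6::6)"
  have "block_matrix P (\<chi> i. Q $ (i + 1)) x (\<chi> i. y $ (i + 1)) = (\<chi> i. block_matrix P Q x y $ ?p i)"
    unfolding vec_eq_iff forall_6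
    by (simp add: block_matrix_def vector_6 numeral_mod_3 Transposition.transpose_def del: One_nat_def)
  moreover have "?p permutes UNIV"
    by (simp add: permutes_compose permutes_swap_id)
  moreover have "sign ?p = 1"
    by (simp add: sign_compose permutation_swap_id sign_swap_id)
  ultimately show ?thesis
    by (simp add: det_permute_rows del: comp_apply)
qed

text \<open>Moving row 3 to fifth place is an even permutation and turns the last two columns into
  unit vectors, so only the upper left 4 x 4 minor contributes.\<close>

lemma det_block_matrix_axis_3:
  "det (block_matrix P Q (axis 3 1) (axis 3 1)) = det4 (P$1) (P$2) (Q$1) (Q$2)"
proof -
  let ?p = "Transposition.transpose 3 4 \<circ> Transposition.transpose 4 (5::6)"
  define A where "A = (\<chi> i. block_matrix P Q (axis 3 1) (axis 3 1) $ ?p i)"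
  have A: "A $ 1 = vector [P$1$1, P$1$2, P$1$3, P$1$4, 0, 0]"
    "A $ 2 = vector [P$2$1, P$2$2, P$2$3, P$2$4, 0, 0]"
    "A $ 3 = vector [Q$1$1, Q$1$2, Q$1$3, Q$1$4, 0, 0]"
    "A $ 4 = vector [Q$2$1, Q$2$2, Q$2$3, Q$2$4, 0, 0]"
    "A $ 5 = vector [P$3$1, P$3$2, P$3$3, P$3$4, 1, 0]"
    "A $ 6 = vector [Q$3$1, Q$3$2, Q$3$3, Q$3$4, 0, 1]"
    by (simp_all add: A_def block_matrix_def vector_6 Transposition.transpose_def axis_def)
  have p: "?p permutes UNIV"
    by (simp add: permutes_compose permutes_swap_id)
  have "sign ?p = 1"
    by (simp add: sign_compose permutation_swap_id sign_swap_id)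
  then have "det (block_matrix P Q (axis 3 1) (axis 3 1)) = det A"
    unfolding A_def det_permute_rows[OF p] by simp
  also have "\<dots> = (\<Sum>p | p permutes {1, 2, 3, 4}. of_int (sign p) * (\<Prod>i\<in>{1, 2, 3, 4}. A $ i $ p i))"
  proof (rule det_eq_sum_permutes)
    fix i :: 6
    assume "i \<notin> {1, 2, 3, 4}"
    then have "i = 5 \<or> i = 6" using exhaust_6[of i] by auto
    then show "column i A = axis i 1"
      unfolding vec_eq_iff forall_6 by (auto simp: column_def A vector_6 axis_def)
  qed
  also have "\<dots> = det4 (P$1) (P$2) (Q$1) (Q$2)"
  proof -
    \<comment> \<open>Splitting off one index at a time enumerates the 24 permutations.\<close>
    have f1: "finite {2::6, 3, 4}" "1 \<notin> {2::6, 3, 4}" by auto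
    have f2: "finite {3::6, 4}" "2 \<notin> {3::6, 4}" by auto
    have f3: "finite {4::6}" "3 \<notin> {4::6}" by auto
    show ?thesis
      unfolding sum_over_permutations_insert[OF f1]
      unfolding sum_over_permutations_insert[OF f2]
      unfolding sum_over_permutations_insert[OF f3]
      unfolding permutes_sing
      by (simp add: sign_swap_id permutation_swap_id permutation_compose sign_compose sign_id A vector_6 det4_def
          Transposition.transpose_def algebra_simps)
  qed
  finally show ?thesis .
qed

lemma det_block_matrix_axis:
  "det (block_matrix P Q (axis a 1) (axis b 1)) =
     det4 (P $ (a + 1)) (P $ (a + 2)) (Q $ (b + 1)) (Q $ (b + 2))"
proof -
  \<comment> \<open>One rotation lowers the index of the unit vector cyclically by one. The left
    index is treated first, with the right one fixed at 3.\<close>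
  have shift: "(\<chi> i. axis a 1 $ (i + 1)) = (axis (a - 1) 1 :: real^3)" for a :: 3
    by (auto simp: vec_eq_iff axis_def)
  have left: "det (block_matrix P Q (axis a 1) y) =
      det (block_matrix (\<chi> i. P $ (i + 1)) Q (axis (a - 1) 1) y)" for P Q a y
    using det_block_matrix_rotate_left[of P Q "axis a 1" y] unfolding shift ..
  have right: "det (block_matrix P Q x (axis b 1)) =
      det (block_matrix P (\<chi> i. Q $ (i + 1)) x (axis (b - 1) 1))" for P Q b x
    using det_block_matrix_rotate_right[of P Q x "axis b 1"] unfolding shift ..
  have row: "det (block_matrix P Q (axis a 1) (axis 3 1)) =
      det4 (P $ (a + 1)) (P $ (a + 2)) (Q $ 1) (Q $ 2)" for P Q a
    using exhaust_3[of a] left[of P Q 1] left[of P Q 2] left[of _ Q 1]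
      det_block_matrix_axis_3[of _ Q]
    by (auto simp: numeral_mod_3 add.assoc)
  show ?thesis
    using exhaust_3[of b] right[of P Q _ 1] right[of P Q _ 2] right[of P _ _ 1] row[of P _ a]
    by (auto simp: numeral_mod_3 add.assoc)
qed

lemma det_column_linear:
  fixes A B C :: "real^'n^'n"
  assumes "\<forall>i. A $ i $ k = c * B $ i $ k + d * C $ i $ k"
    and "\<forall>i j. j \<noteq> k \<longrightarrow> A $ i $ j = B $ i $ j \<and> C $ i $ j = B $ i $ j"
  shows "det A = c * det B + d * det C"
proof -
  let ?r = "\<lambda>v. \<chi> j. if j = k then v else column j B"
  have "det A = det (?r (c *s column k B + d *s column k C))"
    unfolding det_transpose[of A, symmetric]
    by (rule arg_cong[of _ _ det]) (use assms in \<open>auto simp: vec_eq_iff transpose_def column_def\<close>)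
  also have "\<dots> = c * det (?r (column k B)) + d * det (?r (column k C))"
    by (simp add: det_row_add det_row_mul)
  also have "?r (column k B) = transpose B"
    by (auto simp: vec_eq_iff transpose_def column_def)
  also have "?r (column k C) = transpose C"
    using assms by (auto simp: vec_eq_iff transpose_def column_def)
  finally show ?thesis by simp
qed

text \<open>\<open>x\<close> fills column 5 and \<open>y\<close> fills column 6, so the determinant
  is bilinear in them and is fixed by its values on pairs of unit vectors.\<close>

lemma det_block_matrix:
  "det (block_matrix P Q x y) =
     x \<bullet> ((\<chi> a b. det4 (P $ (a + 1)) (P $ (a + 2)) (Q $ (b + 1)) (Q $ (b + 2))) *v y)"
  (is "_ = x \<bullet> (?F *v y)")
proof -
  have left: "det (block_matrix P Q (c *\<^sub>R u + d *\<^sub>R v) y) =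
      c * det (block_matrix P Q u y) + d * det (block_matrix P Q v y)" for c d u v y
    by (rule det_column_linear[where k = 5])
      (use exhaust_6 in \<open>auto simp: block_matrix_def forall_6 vector_6\<close>)
  have right: "det (block_matrix P Q x (c *\<^sub>R u + d *\<^sub>R v)) =
      c * det (block_matrix P Q x u) + d * det (block_matrix P Q x v)" for c d u v x
    by (rule det_column_linear[where k = 6])
      (use exhaust_6 in \<open>auto simp: block_matrix_def forall_6 vector_6\<close>)
  have basis: "u = (\<Sum>k\<in>UNIV. u $ k *\<^sub>R axis k 1)" for u :: "real^3"
    by (simp add: vec_eq_iff axis_def sum.delta if_distrib cong: if_cong)
  \<comment> \<open>The coefficients \<open>c = d = 1\<close> give additivity, and
    \<open>d = 0\<close> gives homogeneity.\<close>
  have linear_left: "linear (\<lambda>u. det (block_matrix P Q u v))" for v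
    using left[of 1 _ 1] left[of _ _ 0] by (intro linearI) simp_all
  have linear_right: "linear (\<lambda>v. det (block_matrix P Q u v))" for u
    using right[of _ 1 _ 1] right[of _ _ _ 0] by (intro linearI) simp_all
  have "det (block_matrix P Q x y) =
      det (block_matrix P Q (\<Sum>a\<in>UNIV. x $ a *\<^sub>R axis a 1) (\<Sum>b\<in>UNIV. y $ b *\<^sub>R axis b 1))"
    using basis by metis
  also have "\<dots> = (\<Sum>b\<in>UNIV. \<Sum>a\<in>UNIV. y $ b * (x $ a * det (block_matrix P Q (axis a 1) (axis b 1))))"
    by (simp add: linear_sum[OF linear_left] linear_sum[OF linear_right] linear_cmul[OF linear_left]
        linear_cmul[OF linear_right] sum_distrib_left)
  also have "\<dots> = x \<bullet> (?F *v y)"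
    unfolding det_block_matrix_axis inner_vec_def matrix_vector_mult_def
    by (subst sum.swap) (simp add: sum_distrib_left mult_ac)
  finally show ?thesis .
qed

text \<open>A matrix is determined by its bilinear form, so the description in
  \<open>psi_def\<close> has exactly one solution.\<close>

lemma psi_eq: "psi P Q = (\<chi> a b. det4 (P $ (a + 1)) (P $ (a + 2)) (Q $ (b + 1)) (Q $ (b + 2)))"
  (is "_ = ?F")
  unfolding psi_def
proof (rule the_equality)
  show "\<forall>x y. det (block_matrix P Q x y) = x \<bullet> (?F *v y)"
    by (simp add: det_block_matrix)
  fix F assume "\<forall>x y. det (block_matrix P Q x y) = x \<bullet> (F *v y)"
  then have "x \<bullet> (F *v y) = x \<bullet> (?F *v y)" for x y
    using det_block_matrix by metis
  then have "F *v y = ?F *v y" for y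
    using vector_eq_ldot by blast
  then show "F = ?F"
    using matrix_eq by blast
qed

section \<open>Pluecker relations and their consequences for the fundamental matrix\<close>

text \<open>Cramer's linear relation between the five vectors \<open>p1, p2, p3, r, s\<close> of a
  four-dimensional space, paired with \<open>u\<close>.\<close>

lemma Plucker_contract:
  "(p1 \<bullet> u) * det4 p2 p3 r s + (p2 \<bullet> u) * det4 p3 p1 r s + (p3 \<bullet> u) * det4 p1 p2 r s
    = det4 p1 p2 p3 s * (r \<bullet> u) - det4 p1 p2 p3 r * (s \<bullet> u)"
  unfolding det4_def inner_vec_def sum_4 inner_real_def
  by algebra

text \<open>The three-term Grassmann-Pluecker relation: every bracket contains \<open>p3\<close> and
  \<open>q3\<close>, and modulo these two the identity concerns four vectors in a plane.\<close>

lemma Plucker_exchange: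
  "det4 p2 p3 q2 q3 * det4 p3 p1 q3 q1 - det4 p2 p3 q3 q1 * det4 p3 p1 q2 q3
   = - (det4 q1 q2 q3 p3 * det4 p1 p2 p3 q3)"
  unfolding det4_def
  by algebra

lemma det4_swap_pairs: "det4 c d a b = det4 a b c d"
  unfolding det4_def by algebra

lemma det4_rotate: "det4 b c a z = det4 a b c z"
  unfolding det4_def by algebra

lemma inner_center: "v \<bullet> center P = det4 (P$1) (P$2) (P$3) v"
  unfolding center_def inner_vec_def sum_4 det4_def
  by (simp add: axis_def) algebra

lemma matrix_vector_mult_nth: "(A *v x) $ i = A $ i \<bullet> x" for A :: "real^'n^'m"
  by (simp add: matrix_vector_mult_def inner_vec_def)

lemma psi_transpose: "transpose (psi P Q) = psi Q P"
  by (simp add: psi_eq transpose_def vec_eq_iff det4_swap_pairs)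

lemma cross3_nth: "(x \<times> y) $ i = x $ (i + 1) * y $ (i + 2) - x $ (i + 2) * y $ (i + 1)"
  using exhaust_3[of i] by (auto simp: cross3_def numeral_mod_3)

text \<open>The rows of \<open>Q\<close> and two rows of \<open>P\<close> are the five vectors of
  \<open>Plucker_contract\<close>. Geometrically the right-hand side is the epipolar line of
  \<open>v\<close> in the first image, joining the image of \<open>v\<close> to the epipole.\<close>

lemma psi_mult: "psi P Q *v (Q *v v) = (P *v v) \<times> (P *v center Q)"
proof -
  have "(psi P Q *v (Q *v v)) $ a = ((P *v v) \<times> (P *v center Q)) $ a" for a
    using Plucker_contract[of "Q $ 1" v "Q $ 2" "Q $ 3" "P $ (a + 1)" "P $ (a + 2)"]
    by (simp add: cross3_nth matrix_vector_mult_nth inner_center inner_vec_def[of _ "Q *v v"] sum_3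
        psi_eq numeral_mod_3 det4_swap_pairs[of _ _ "P $ (a + 1)" "P $ (a + 2)"])
      (simp add: algebra_simps)
  then show ?thesis by (simp add: vec_eq_iff)
qed

lemma add_mod_3: "i + 1 + 1 = i + 2" "i + 1 + 2 = i" "i + 2 + 1 = i" "i + 2 + 2 = i + 1" for i :: 3
  using exhaust_3[of i] by (auto simp: numeral_mod_3)

lemma inner_center_rotate: "v \<bullet> center P = det4 (P $ (i + 1)) (P $ (i + 2)) (P $ i) v"
  using exhaust_3[of i] by (auto simp: inner_center numeral_mod_3 det4_rotate)

text \<open>The four brackets in this 2 x 2 minor all share row \<open>a\<close> of \<open>P\<close>
  and row \<open>b\<close> of \<open>Q\<close>, so \<open>Plucker_exchange\<close> factors the minor
  into a product of epipole coordinates.\<close>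

lemma cof3_psi: "cof3 (psi P Q) $ a $ b = - ((P *v center Q) $ a * (Q *v center P) $ b)"
  using Plucker_exchange[of "P $ (a + 2)" "P $ a" "Q $ (b + 2)" "Q $ b" "P $ (a + 1)" "Q $ (b + 1)"]
  by (simp add: cof3_def cross3_nth psi_eq matrix_vector_mult_nth inner_center_rotate[of _ Q b]
      inner_center_rotate[of _ P a] add_mod_3 del: add_2_eq_Suc add_2_eq_Suc')

text \<open>Cauchy-Binet for the product of \<open>P\<close> with the matrix of columns
  \<open>u, v, w\<close>, the maximal minors of \<open>P\<close> being collected in its
  centre.\<close>

lemma det_mult_center: "(P *v u) \<bullet> ((P *v v) \<times> (P *v w)) = det4 u v w (center P)"
  unfolding center_def inner_vec_def sum_3 cross3_nth matrix_vector_mult_def sum_4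
  by (simp add: numeral_mod_3 axis_def det4_def del: mult_cancel_left mult_cancel_right) algebra

section \<open>Epipoles and cofactors\<close>

lemma det_eq_inner_cof3: "det F = F $ a \<bullet> cof3 F $ a"
  using exhaust_3[of a]
  by (auto simp: det_3 cof3_def cross3_nth inner_vec_def sum_3 numeral_mod_3 algebra_simps)

text \<open>The adjugate identity: row \<open>a\<close> of \<open>F\<close> pairs with the cofactor
  row to the determinant, while the other rows are orthogonal to their own cross product.\<close>

lemma mult_cof3:
  assumes "det F = 0"
  shows "F *v cof3 F $ a = 0"
proof -
  have "F $ i \<bullet> cof3 F $ a = 0" for i
  proof -
    have "i = a \<or> i = a + 1 \<or> i = a + 2"
      using exhaust_3[of a] exhaust_3[of i] by (auto simp: numeral_mod_3)
    then show ?thesis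
      using assms det_eq_inner_cof3[of F a] by (auto simp: cof3_def dot_cross_self)
  qed
  then show ?thesis
    by (simp add: vec_eq_iff matrix_vector_mult_nth)
qed

lemma in_span_singleton_if_cross_eq_0:
  assumes "x \<times> y = 0" "x \<noteq> 0"
  shows "y \<in> span {x}"
  using assms by (auto simp: cross_eq_0 collinear_lemma span_singleton)

text \<open>All 2 x 2 minors vanish exactly when the rows are multiples of a single vector.\<close>

lemma rank_eq_2_iff_cof3:
  assumes "det F = 0"
  shows "rank F = 2 \<longleftrightarrow> cof3 F \<noteq> 0"
proof
  assume r: "rank F = 2"
  show "cof3 F \<noteq> 0"
  proof
    assume c: "cof3 F = 0"
    from r obtain a where a: "F $ a \<noteq> 0"
      using rank_0 by (metis vec_eq_iff zero_index zero_neq_numeral)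
    have "F $ i \<in> span {F $ a}" for i
    proof -
      \<comment> \<open>These two cofactor rows are, up to sign, the cross products of the nonzero
        row \<open>a\<close> with the other two rows.\<close>
      have "cof3 F $ (a + 1) = 0" "cof3 F $ (a + 2) = 0"
        using c by simp_all
      then have "F $ a \<times> F $ (a + 1) = 0" "F $ a \<times> F $ (a + 2) = 0"
        using cross_skew[of "F $ a" "F $ (a + 2)"]
        by (simp_all add: cof3_def add_mod_3)
      moreover have "i = a \<or> i = a + 1 \<or> i = a + 2"
        using exhaust_3[of a] exhaust_3[of i] by (auto simp: numeral_mod_3)
      ultimately show ?thesis
        using a in_span_singleton_if_cross_eq_0 span_base by auto
    qed
    then have "rows F \<subseteq> span {F $ a}"
      by (auto simp: rows_def row_def)
    then have "dim (rows F) \<le> card {F $ a}"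
      by (intro dim_le_card) auto
    then show False
      using r by (simp add: row_rank_def)
  qed
next
  assume "cof3 F \<noteq> 0"
  then obtain a where a: "F $ (a + 1) \<times> F $ (a + 2) \<noteq> 0"
    by (auto simp: cof3_def vec_eq_iff)
  have "rank F < 3"
    using assms det_eq_0_rank by force
  moreover have "\<not> rank F \<le> 1"
  proof
    assume le: "rank F \<le> 1"
    obtain B where B: "B \<subseteq> rows F" "independent B" "rows F \<subseteq> span B" "card B = rank F"
      using basis_exists unfolding row_rank_def by metis
    have "finite B" using B(2) independent_imp_finite by blast
    with B(4) le obtain v where "B \<subseteq> {v}"
      by (metis One_nat_def card_0_eq card_1_singletonE empty_subsetI le_Suc_eq le_zero_eq order_refl)
    then have "rows F \<subseteq> span {v}"
      using B(3) span_mono by blast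
    then have "F $ i \<in> span {v}" for i
      by (auto simp: rows_def row_def)
    then have "\<exists>k. F $ i = k *\<^sub>R v" for i
      by (auto simp: span_singleton)
    then obtain k l where "F $ (a + 1) = k *\<^sub>R v" "F $ (a + 2) = l *\<^sub>R v"
      by blast
    with a show False
      by (simp add: cross_mult_left cross_mult_right)
  qed
  ultimately show "rank F = 2" by linarith
qed

text \<open>By Lagrange's formula for the double cross product, a vector orthogonal to all rows is
  parallel to the cross product of two of them.\<close>

lemma kernel_eq_span_cof3:
  assumes "det F = 0" "cof3 F $ a \<noteq> 0"
  shows "{u. F *v u = 0} = span {cof3 F $ a}"
proof (intro set_eqI iffI)
  fix u assume "u \<in> {u. F *v u = 0}"
  then have "F $ i \<bullet> u = 0" for i
    by (simp add: matrix_vector_mult_nth[symmetric])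
  then have "u \<times> cof3 F $ a = 0"
    by (simp add: cof3_def Lagrange inner_commute)
  then show "u \<in> span {cof3 F $ a}"
    using assms(2) cross_skew[of u] by (intro in_span_singleton_if_cross_eq_0) auto
next
  fix u assume "u \<in> span {cof3 F $ a}"
  then show "u \<in> {u. F *v u = 0}"
    using mult_cof3[OF assms(1), of a] by (auto simp: span_singleton matrix_vector_mult_scaleR)
qed

lemma span_epipole:
  assumes "det (fmat x i j) = 0" "cof3 (fmat x i j) $ a \<noteq> 0"
  shows "span {epipole x i j} = span {cof3 (fmat x i j) $ a}"
proof -
  have "rank (fmat x i j) = 2"
    using assms rank_eq_2_iff_cof3 by force
  moreover have "span {SOME v. span {v} = {u. fmat x i j *v u = 0}} = {u. fmat x i j *v u = 0}"
    \<comment> \<open>The nonzero cofactor row witnesses that the choice of a spanning vector is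
      possible.\<close>
    by (rule someI[of _ "cof3 (fmat x i j) $ a"]) (use kernel_eq_span_cof3[OF assms] in simp)
  ultimately show ?thesis
    using kernel_eq_span_cof3[OF assms] by (simp add: epipole_def)
qed

text \<open>The scalar may be zero, which covers vanishing cofactor rows and hence rank one.\<close>

lemma cof3_eq_scale_epipole:
  assumes "det (fmat x i j) = 0"
  shows "\<exists>k. cof3 (fmat x i j) $ a = k *\<^sub>R epipole x i j"
proof (cases "cof3 (fmat x i j) $ a = 0")
  case True
  then show ?thesis by (intro exI[of _ 0]) simp
next
  case False
  then have "cof3 (fmat x i j) $ a \<in> span {epipole x i j}"
    using span_epipole[OF assms False] span_base by auto
  then show ?thesis by (auto simp: span_singleton)
qed

text \<open>The row \<open>a\<close> depends on the matrix, because any particular cofactor row may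
  vanish although the rank is two.\<close>

lemma epipole_eq_scale_cof3:
  assumes "det (fmat x i j) = 0"
  shows "\<exists>a k. epipole x i j = k *\<^sub>R cof3 (fmat x i j) $ a"
proof (cases "cof3 (fmat x i j) = 0")
  case True
  then have "epipole x i j = 0"
    using rank_eq_2_iff_cof3[OF assms] by (simp add: epipole_def)
  then show ?thesis by (intro exI[of _ 0]) simp
next
  case False
  then obtain a where a: "cof3 (fmat x i j) $ a \<noteq> 0"
    by (auto simp: vec_eq_iff)
  then have "epipole x i j \<in> span {cof3 (fmat x i j) $ a}"
    using span_epipole[OF assms a] span_base by auto
  then show ?thesis by (auto simp: span_singleton)
qed

section \<open>Multihomogeneous polynomials\<close>

text \<open>Keeps the multidegree explicit, so that degrees can be added in products and compared in
  sums.\<close>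

definition mhpoly :: "'e set \<Rightarrow> ('e \<Rightarrow> nat) \<Rightarrow> (('e \<Rightarrow> real^'k^'m) \<Rightarrow> real) \<Rightarrow> bool" where
  "mhpoly E d p \<longleftrightarrow>
     poly_fun E p \<and> (\<forall>e\<in>E. \<forall>c M. p (M(e := c *\<^sub>R M e)) = c ^ d e * p M)"

lemma mhpoly_coord:
  assumes "e \<in> E"
  shows "mhpoly E (\<lambda>e'. if e' = e then 1 else 0) (\<lambda>M. M e $ i $ j)"
  using assms by (auto simp: mhpoly_def intro: poly_fun.coord)

lemma mhpoly_mult:
  "mhpoly E d p \<Longrightarrow> mhpoly E d' q \<Longrightarrow> mhpoly E (\<lambda>e. d e + d' e) (\<lambda>M. p M * q M)"
  by (auto simp: mhpoly_def power_add intro: poly_fun.mult)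

lemma mhpoly_add: "mhpoly E d p \<Longrightarrow> mhpoly E d q \<Longrightarrow> mhpoly E d (\<lambda>M. p M + q M)"
  by (auto simp: mhpoly_def algebra_simps intro: poly_fun.add)

lemma mhpoly_diff:
  assumes "mhpoly E d p" "mhpoly E d q"
  shows "mhpoly E d (\<lambda>M. p M - q M)"
proof -
  have "poly_fun E (\<lambda>M. p M + (-1) * q M)"
    using poly_fun.add[of E p, OF _ poly_fun.mult[OF poly_fun.const[of E "-1"]]] assms
    unfolding mhpoly_def by blast
  then have "poly_fun E (\<lambda>M. p M - q M)"
    by simp
  then show ?thesis
    using assms by (simp add: mhpoly_def right_diff_distrib)
qed

lemma mhpoly_inner:
  fixes u v :: "('e \<Rightarrow> real^'k^'m) \<Rightarrow> real^3"
  assumes "\<And>a. mhpoly E d (\<lambda>M. u M $ a)" "\<And>a. mhpoly E d' (\<lambda>M. v M $ a)"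
  shows "mhpoly E (\<lambda>e. d e + d' e) (\<lambda>M. u M \<bullet> v M)"
  unfolding inner_vec_def sum_3 inner_real_def by (intro mhpoly_add mhpoly_mult assms)

lemma mhpoly_matrix_vector_mult:
  fixes A :: "('e \<Rightarrow> real^'k^'m) \<Rightarrow> real^3^3"
  assumes "\<And>a b. mhpoly E d (\<lambda>M. A M $ a $ b)" "\<And>a. mhpoly E d' (\<lambda>M. v M $ a)"
  shows "mhpoly E (\<lambda>e. d e + d' e) (\<lambda>M. (A M *v v M) $ a)"
  unfolding matrix_vector_mult_nth by (intro mhpoly_inner assms)

lemma mhpoly_cross3:
  assumes "\<And>a. mhpoly E d (\<lambda>M. u M $ a)" "\<And>a. mhpoly E d' (\<lambda>M. v M $ a)"
  shows "mhpoly E (\<lambda>e. d e + d' e) (\<lambda>M. (u M \<times> v M) $ a)"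
  unfolding cross3_nth by (intro mhpoly_diff mhpoly_mult assms)

lemma mhpoly_cof3:
  assumes "\<And>a b. mhpoly E d (\<lambda>M. A M $ a $ b)"
  shows "mhpoly E (\<lambda>e. d e + d e) (\<lambda>M. cof3 (A M) $ a $ b)"
  unfolding cof3_def vec_lambda_beta by (intro mhpoly_cross3 assms)

lemma mhpoly_det:
  assumes "\<And>a b. mhpoly E d (\<lambda>M. A M $ a $ b :: real)"
  shows "mhpoly E (\<lambda>e. d e + (d e + d e)) (\<lambda>M. det (A M :: real^3^3))"
  unfolding det_eq_inner_cof3[of _ 1] by (intro mhpoly_inner mhpoly_cof3 assms)

lemma zariski_closedI:
  assumes "\<And>p. p \<in> S \<Longrightarrow> \<exists>d. mhpoly E d p"
    and "Z = {x \<in> E \<rightarrow>\<^sub>E UNIV. \<forall>p\<in>S. p (\<lambda>e. rep_proj_mat (x e)) = 0}"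
  shows "zariski_closed E Z"
  unfolding zariski_closed_def
proof (intro exI conjI ballI)
  fix p assume "p \<in> S"
  then obtain d where "mhpoly E d p" using assms(1) by blast
  then show "poly_fun E p" "multihomogeneous E p"
    by (auto simp: mhpoly_def multihomogeneous_def)
qed (rule assms(2))

section \<open>The constraints as polynomials in the matrices on the edges\<close>

text \<open>The counterpart of \<open>fmat\<close> on tuples of matrices instead of projective
  points, so that expressions in it are polynomial functions.\<close>

definition edge_mat :: "(nat \<times> nat \<Rightarrow> real^3^3) \<Rightarrow> nat \<Rightarrow> nat \<Rightarrow> real^3^3" where
  "edge_mat M i j = (if i < j then M (i, j) else transpose (M (j, i)))"

definition edge_deg :: "nat \<Rightarrow> nat \<Rightarrow> nat \<times> nat \<Rightarrow> nat" where
  "edge_deg i j e = (if e = (min i j, max i j) then 1 else 0)"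

lemma edge_deg_commute: "edge_deg i j e = edge_deg j i e"
  by (simp add: edge_deg_def min.commute max.commute)

lemma fmat_eq: "fmat x i j = edge_mat (\<lambda>e. rep_proj_mat (x e)) i j"
  by (simp add: fmat_def edge_mat_def)

lemma mhpoly_edge_mat:
  assumes "i \<in> {1..n}" "j \<in> {1..n}" "i \<noteq> j"
  shows "mhpoly (edges n) (edge_deg i j) (\<lambda>M. edge_mat M i j $ a $ b)"
proof (cases "i < j")
  case True
  then show ?thesis
    using assms mhpoly_coord[of "(i, j)" "edges n"]
    by (simp add: edges_def edge_mat_def edge_deg_def[abs_def] min_def max_def)
next
  case False
  then show ?thesis
    using assms mhpoly_coord[of "(j, i)" "edges n"]
    by (simp add: edges_def edge_mat_def edge_deg_def[abs_def] min_def max_def transpose_def)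
qed

text \<open>By homogeneity in the epipoles, each of them may be replaced in the constraints by the rows
  of a cofactor matrix; these are polynomial, and they all vanish exactly when the rank drops to
  one.\<close>

definition cof_form ::
  "(nat \<Rightarrow> nat \<Rightarrow> 3) \<Rightarrow> (nat \<times> nat \<Rightarrow> real^3^3) \<Rightarrow> nat \<Rightarrow> nat \<Rightarrow> nat \<Rightarrow> nat \<Rightarrow> real" where
  "cof_form r M s i j t =
     cof3 (edge_mat M s i) $ r s i \<bullet> (edge_mat M i j *v cof3 (edge_mat M t j) $ r t j)"

definition cof_quad ::
  "(nat \<Rightarrow> nat \<Rightarrow> 3) \<Rightarrow> nat \<Rightarrow> nat \<Rightarrow> nat \<Rightarrow> nat \<Rightarrow> (nat \<times> nat \<Rightarrow> real^3^3) \<Rightarrow> real" where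
  "cof_quad r a b c d M =
     cof_form r M d a b c * cof_form r M b a c d * cof_form r M c a d b *
     cof_form r M d b c a * cof_form r M a b d c * cof_form r M b c d a -
     cof_form r M c a b d * cof_form r M d a c b * cof_form r M b a d c *
     cof_form r M a b c d * cof_form r M c b d a * cof_form r M a c d b"

lemma mhpoly_cof_form:
  assumes "{s, i, j, t} \<subseteq> {1..n}" "s \<noteq> i" "i \<noteq> j" "t \<noteq> j"
  shows "mhpoly (edges n)
     (\<lambda>e. (edge_deg s i e + edge_deg s i e) + (edge_deg i j e + (edge_deg t j e + edge_deg t j e)))
     (\<lambda>M. cof_form r M s i j t)"
  unfolding cof_form_def
  by (intro mhpoly_inner mhpoly_matrix_vector_mult mhpoly_cof3 mhpoly_edge_mat) (use assms in auto)

text \<open>In both products each of the twelve ordered pairs of indices gives one cofactor row and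
  each of the six edges gives one middle factor. A cofactor row is quadratic, so both products have
  degree five in each of the six matrices.\<close>

lemma mhpoly_cof_quad:
  assumes "{a, b, c, d} \<subseteq> {1..n}" "distinct [a, b, c, d]"
  shows "\<exists>D. mhpoly (edges n) D (cof_quad r a b c d)"
proof -
  let ?w = "\<lambda>s i j t e. (edge_deg s i e + edge_deg s i e) +
    (edge_deg i j e + (edge_deg t j e + edge_deg t j e))"
  have form: "mhpoly (edges n) (?w s i j t) (\<lambda>M. cof_form r M s i j t)"
    if "(s, i, j, t) \<in> {(d, a, b, c), (b, a, c, d), (c, a, d, b), (d, b, c, a), (a, b, d, c), (b, c, d, a),
      (c, a, b, d), (d, a, c, b), (b, a, d, c), (a, b, c, d), (c, b, d, a), (a, c, d, b)}" for s i j t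
    by (rule mhpoly_cof_form) (use assms that in auto)
  have prod6: "mhpoly (edges n) (\<lambda>e. d1 e + d2 e + d3 e + d4 e + d5 e + d6 e)
      (\<lambda>M. p1 M * p2 M * p3 M * p4 M * p5 M * p6 M)"
    if "mhpoly (edges n) d1 p1" "mhpoly (edges n) d2 p2" "mhpoly (edges n) d3 p3"
      "mhpoly (edges n) d4 p4" "mhpoly (edges n) d5 p5" "mhpoly (edges n) d6 p6"
    for d1 d2 d3 d4 d5 d6 and p1 p2 p3 p4 p5 p6 :: "(nat \<times> nat \<Rightarrow> real^3^3) \<Rightarrow> real"
    by (intro mhpoly_mult that)
  let ?L = "\<lambda>e. ?w d a b c e + ?w b a c d e + ?w c a d b e + ?w d b c a e + ?w a b d c e + ?w b c d a e"
  let ?R = "\<lambda>e. ?w c a b d e + ?w d a c b e + ?w b a d c e + ?w a b c d e + ?w c b d a e + ?w a c d b e"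
  have L: "mhpoly (edges n) ?L (\<lambda>M.
      cof_form r M d a b c * cof_form r M b a c d * cof_form r M c a d b *
      cof_form r M d b c a * cof_form r M a b d c * cof_form r M b c d a)"
    by (rule prod6; rule form) simp_all
  have R: "mhpoly (edges n) ?R (\<lambda>M.
      cof_form r M c a b d * cof_form r M d a c b * cof_form r M b a d c *
      cof_form r M a b c d * cof_form r M c b d a * cof_form r M a c d b)"
    by (rule prod6; rule form) simp_all
  have degree: "?R e = ?L e" for e
    using edge_deg_commute[of b a e] edge_deg_commute[of c a e] edge_deg_commute[of d a e]
      edge_deg_commute[of c b e] edge_deg_commute[of d b e] edge_deg_commute[of d c e]
    by linarith
  have "mhpoly (edges n) ?L (\<lambda>M.
      cof_form r M c a b d * cof_form r M d a c b * cof_form r M b a d c *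
      cof_form r M a b c d * cof_form r M c b d a * cof_form r M a c d b)"
    by (rule back_subst[where P = "\<lambda>D. mhpoly (edges n) D _", OF R ext[OF degree]])
  from mhpoly_diff[OF L this] show ?thesis
    unfolding cof_quad_def[abs_def] by (rule exI[of _ ?L])
qed

lemma scaled_cof_form:
  assumes "\<And>i j. i \<in> V \<Longrightarrow> j \<in> V \<Longrightarrow> i \<noteq> j \<Longrightarrow> cof3 (fmat x i j) $ r i j = k i j *\<^sub>R epipole x i j"
    and "{s, i, j, t} \<subseteq> V" "s \<noteq> i" "t \<noteq> j"
  shows "cof_form r (\<lambda>e. rep_proj_mat (x e)) s i j t = k s i * k t j * epi_form x s i j t"
  using assms by (simp add: cof_form_def epi_form_def fmat_eq[symmetric] matrix_vector_mult_scaleR)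

lemma scaled_epi_form:
  assumes "\<And>i j. i \<in> V \<Longrightarrow> j \<in> V \<Longrightarrow> i \<noteq> j \<Longrightarrow> epipole x i j = k i j *\<^sub>R cof3 (fmat x i j) $ r i j"
    and "{s, i, j, t} \<subseteq> V" "s \<noteq> i" "t \<noteq> j"
  shows "epi_form x s i j t = k s i * k t j * cof_form r (\<lambda>e. rep_proj_mat (x e)) s i j t"
  using assms by (simp add: cof_form_def epi_form_def fmat_eq[symmetric] matrix_vector_mult_scaleR)

text \<open>Abstracts from the form \<open>f\<close>, since the same relation is needed for the
  epipoles, for the cofactor rows and for brackets of camera centres.\<close>

definition quad_constraint :: "(nat \<Rightarrow> nat \<Rightarrow> nat \<Rightarrow> nat \<Rightarrow> real) \<Rightarrow> nat \<Rightarrow> nat \<Rightarrow> nat \<Rightarrow> nat \<Rightarrow> bool" where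
  "quad_constraint f a b c d \<longleftrightarrow>
        f d a b c * f b a c d * f c a d b * f d b c a * f a b d c * f b c d a =
        f c a b d * f d a c b * f b a d c * f a b c d * f c b d a * f a c d b"

text \<open>Each ordered pair of indices occurs once as an epipole on either side, so the scalars
  collect into the common factor \<open>?K\<close>. They may be zero, so the constraint passes from
  \<open>g\<close> to \<open>f\<close> only.\<close>

lemma quad_constraint_scale:
  assumes "\<And>s i j t. {s, i, j, t} \<subseteq> {a, b, c, d} \<Longrightarrow> distinct [s, i, j, t] \<Longrightarrow>
      f s i j t = k s i * k t j * g s i j t"
    and "distinct [a, b, c, d]" "quad_constraint g a b c d"
  shows "quad_constraint f a b c d"
proof -
  let ?K = "k d a * k c b * k b a * k d c * k c a * k b d * k d b * k a c * k a b * k c d * k b c * k a d"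
  let ?L = "g d a b c * g b a c d * g c a d b * g d b c a * g a b d c * g b c d a"
  let ?R = "g c a b d * g d a c b * g b a d c * g a b c d * g c b d a * g a c d b"
  have f: "f s i j t = k s i * k t j * g s i j t"
    if "(s, i, j, t) \<in> {(d, a, b, c), (b, a, c, d), (c, a, d, b), (d, b, c, a), (a, b, d, c), (b, c, d, a),
      (c, a, b, d), (d, a, c, b), (b, a, d, c), (a, b, c, d), (c, b, d, a), (a, c, d, b)}" for s i j t
    by (rule assms(1)) (use assms(2) that in auto)
  have "f d a b c * f b a c d * f c a d b * f d b c a * f a b d c * f b c d a = ?K * ?L"
    by (simp only: f insert_iff simp_thms) (simp only: mult_ac)
  moreover have "f c a b d * f d a c b * f b a d c * f a b c d * f c b d a * f a c d b = ?K * ?R"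
    by (simp only: f insert_iff simp_thms) (simp only: mult_ac)
  ultimately show ?thesis
    using assms(3) unfolding quad_constraint_def by simp
qed

lemma det_fmat_eq_0:
  assumes "\<forall>e\<in>edges n. det (rep_proj_mat (x e)) = 0" "i \<in> {1..n}" "j \<in> {1..n}" "i \<noteq> j"
  shows "det (fmat x i j) = 0"
proof (cases "i < j")
  case True
  then have "(i, j) \<in> edges n" using assms by (simp add: edges_def)
  then show ?thesis using assms(1) True by (simp add: fmat_def)
next
  case False
  then have "(j, i) \<in> edges n" using assms by (simp add: edges_def)
  then show ?thesis using assms(1) False by (simp add: fmat_def)
qed

lemma rank_le_2_iff: "rank F \<le> 2 \<longleftrightarrow> det F = 0" for F :: "real^3^3"
  using det_eq_0_rank[of F] by auto

text \<open>Epipoles are not polynomial in the matrices, but cofactor rows are. Every cofactor row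
  is a multiple of the epipole, and every epipole is a multiple of some cofactor row; quantifying
  over all selections \<open>r\<close> of rows makes the two systems of constraints
  equivalent.\<close>

lemma constraint_variety_eq:
  "constraint_variety n = {x \<in> edges n \<rightarrow>\<^sub>E UNIV.
     (\<forall>e\<in>edges n. det (rep_proj_mat (x e)) = 0) \<and>
     (\<forall>r. \<forall>i\<in>{1..n}. \<forall>j\<in>{1..n}. \<forall>k\<in>{1..n}. i < j \<and> k \<noteq> i \<and> k \<noteq> j \<longrightarrow>
        cof_form r (\<lambda>e. rep_proj_mat (x e)) k i j k = 0) \<and>
     (\<forall>r. \<forall>a\<in>{1..n}. \<forall>b\<in>{1..n}. \<forall>c\<in>{1..n}. \<forall>d\<in>{1..n}. a < b \<and> b < c \<and> c < d \<longrightarrow>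
        cof_quad r a b c d (\<lambda>e. rep_proj_mat (x e)) = 0)}"
proof -
  have quad: "quadruple_constraints n x \<longleftrightarrow>
     (\<forall>a\<in>{1..n}. \<forall>b\<in>{1..n}. \<forall>c\<in>{1..n}. \<forall>d\<in>{1..n}. a < b \<and> b < c \<and> c < d \<longrightarrow>
        quad_constraint (epi_form x) a b c d)" for x
    by (simp add: quadruple_constraints_def quad_constraint_def)
  have cquad: "cof_quad r a b c d M = 0 \<longleftrightarrow> quad_constraint (cof_form r M) a b c d" for r a b c d M
    by (simp add: cof_quad_def quad_constraint_def)
  have "(\<forall>(i, j)\<in>edges n. rank (fmat x i j) \<le> 2) \<longleftrightarrow> (\<forall>e\<in>edges n. det (rep_proj_mat (x e)) = 0)" for x
    by (auto simp: rank_le_2_iff fmat_def edges_def)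
  moreover have "triple_constraints n x \<and> quadruple_constraints n x \<longleftrightarrow>
     (\<forall>r. \<forall>i\<in>{1..n}. \<forall>j\<in>{1..n}. \<forall>k\<in>{1..n}. i < j \<and> k \<noteq> i \<and> k \<noteq> j \<longrightarrow>
        cof_form r (\<lambda>e. rep_proj_mat (x e)) k i j k = 0) \<and>
     (\<forall>r. \<forall>a\<in>{1..n}. \<forall>b\<in>{1..n}. \<forall>c\<in>{1..n}. \<forall>d\<in>{1..n}. a < b \<and> b < c \<and> c < d \<longrightarrow>
        cof_quad r a b c d (\<lambda>e. rep_proj_mat (x e)) = 0)" (is "_ \<longleftrightarrow> ?T \<and> ?Q")
    if det: "\<forall>e\<in>edges n. det (rep_proj_mat (x e)) = 0" for x
  proof -
    have det: "det (fmat x i j) = 0" if "i \<in> {1..n}" "j \<in> {1..n}" "i \<noteq> j" for i j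
      using det_fmat_eq_0[OF det that] .
    show ?thesis
    proof (intro iffI conjI)
      assume *: "triple_constraints n x \<and> quadruple_constraints n x"
      have scale: "\<exists>k. \<forall>s i j t. {s, i, j, t} \<subseteq> {1..n} \<longrightarrow> s \<noteq> i \<longrightarrow> t \<noteq> j \<longrightarrow>
          cof_form r (\<lambda>e. rep_proj_mat (x e)) s i j t = k s i * k t j * epi_form x s i j t" for r
      proof -
        have "\<forall>i j. \<exists>k. i \<in> {1..n} \<longrightarrow> j \<in> {1..n} \<longrightarrow> i \<noteq> j \<longrightarrow>
            cof3 (fmat x i j) $ r i j = k *\<^sub>R epipole x i j"
          using cof3_eq_scale_epipole[OF det] by blast
        then obtain k where "\<forall>i j. i \<in> {1..n} \<longrightarrow> j \<in> {1..n} \<longrightarrow> i \<noteq> j \<longrightarrow>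
            cof3 (fmat x i j) $ r i j = k i j *\<^sub>R epipole x i j"
          by (auto simp only: choice_iff)
        then show ?thesis
          by (intro exI[of _ k] allI impI scaled_cof_form[of "{1..n}"]) auto
      qed
      show ?T
      proof (intro allI ballI impI)
        fix r i j k
        assume "i \<in> {1..n}" "j \<in> {1..n}" "k \<in> {1..n}" "i < j \<and> k \<noteq> i \<and> k \<noteq> j"
        then show "cof_form r (\<lambda>e. rep_proj_mat (x e)) k i j k = 0"
          using * scale[of r] by (auto simp: triple_constraints_def)
      qed
      show ?Q
        unfolding cquad
      proof (intro allI ballI impI)
        fix r a b c d
        assume V: "a \<in> {1..n}" "b \<in> {1..n}" "c \<in> {1..n}" "d \<in> {1..n}" and less: "a < b \<and> b < c \<and> c < d"
        obtain k where k: "\<forall>s i j t. {s, i, j, t} \<subseteq> {1..n} \<longrightarrow> s \<noteq> i \<longrightarrow> t \<noteq> j \<longrightarrow>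
          cof_form r (\<lambda>e. rep_proj_mat (x e)) s i j t = k s i * k t j * epi_form x s i j t"
          using scale by blast
        show "quad_constraint (cof_form r (\<lambda>e. rep_proj_mat (x e))) a b c d"
        proof (rule quad_constraint_scale)
          show "distinct [a, b, c, d]" using less by auto
          show "quad_constraint (epi_form x) a b c d"
            using * V less unfolding quad by blast
          fix s i j t
          assume "{s, i, j, t} \<subseteq> {a, b, c, d}" "distinct [s, i, j, t]"
          moreover have "{a, b, c, d} \<subseteq> {1..n}" using V by simp
          ultimately show "cof_form r (\<lambda>e. rep_proj_mat (x e)) s i j t = k s i * k t j * epi_form x s i j t"
            using k by (metis distinct_length_2_or_more subset_trans)
        qed
      qed
    next
      assume *: "?T \<and> ?Q"
      \<comment> \<open>For the converse one selection of rows \<open>r\<close> is made that fits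
        all epipoles of \<open>x\<close> at once.\<close>
      have "\<forall>i j. \<exists>a k. i \<in> {1..n} \<longrightarrow> j \<in> {1..n} \<longrightarrow> i \<noteq> j \<longrightarrow>
          epipole x i j = k *\<^sub>R cof3 (fmat x i j) $ a"
        using epipole_eq_scale_cof3[OF det] by blast
      then obtain r k where rk: "\<forall>i j. i \<in> {1..n} \<longrightarrow> j \<in> {1..n} \<longrightarrow> i \<noteq> j \<longrightarrow>
          epipole x i j = k i j *\<^sub>R cof3 (fmat x i j) $ r i j"
        by (auto simp only: choice_iff)
      have scale: "epi_form x s i j t = k s i * k t j * cof_form r (\<lambda>e. rep_proj_mat (x e)) s i j t"
        if "{s, i, j, t} \<subseteq> {1..n}" "s \<noteq> i" "t \<noteq> j" for s i j t
        by (rule scaled_epi_form[of "{1..n}"]) (use rk that in auto)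
      show "triple_constraints n x"
        unfolding triple_constraints_def
      proof (intro ballI impI)
        fix i j k
        assume "i \<in> {1..n}" "j \<in> {1..n}" "k \<in> {1..n}" "i < j \<and> k \<noteq> i \<and> k \<noteq> j"
        then show "epi_form x k i j k = 0"
          using * scale[of k i j k] by auto
      qed
      show "quadruple_constraints n x"
        unfolding quad
      proof (intro ballI impI)
        fix a b c d
        assume V: "a \<in> {1..n}" "b \<in> {1..n}" "c \<in> {1..n}" "d \<in> {1..n}" and less: "a < b \<and> b < c \<and> c < d"
        show "quad_constraint (epi_form x) a b c d"
        proof (rule quad_constraint_scale)
          show "distinct [a, b, c, d]" using less by auto
          show "quad_constraint (cof_form r (\<lambda>e. rep_proj_mat (x e))) a b c d"
            using * V less unfolding cquad by blast
          fix s i j t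
          assume "{s, i, j, t} \<subseteq> {a, b, c, d}" "distinct [s, i, j, t]"
          moreover have "{a, b, c, d} \<subseteq> {1..n}" using V by simp
          ultimately show "epi_form x s i j t = k s i * k t j * cof_form r (\<lambda>e. rep_proj_mat (x e)) s i j t"
            by (intro scale) auto
        qed
      qed
    qed
  qed
  ultimately show ?thesis
    unfolding constraint_variety_def by (simp only: cong: conj_cong)
qed

lemma zariski_closed_constraint_variety: "zariski_closed (edges n) (constraint_variety n)"
proof (rule zariski_closedI)
  define S1 where "S1 = {\<lambda>M :: nat \<times> nat \<Rightarrow> real^3^3. det (M e) | e. e \<in> edges n}"
  define S2 where "S2 = (\<Union>r. \<Union>i\<in>{1..n}. \<Union>j\<in>{1..n}. \<Union>k\<in>{1..n}.
    {p. p = (\<lambda>M. cof_form r M k i j k) \<and> i < j \<and> k \<noteq> i \<and> k \<noteq> j})"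
  define S3 where "S3 = (\<Union>r. \<Union>a\<in>{1..n}. \<Union>b\<in>{1..n}. \<Union>c\<in>{1..n}. \<Union>d\<in>{1..n}.
    {p. p = cof_quad r a b c d \<and> a < b \<and> b < c \<and> c < d})"
  show "\<exists>d. mhpoly (edges n) d p" if "p \<in> S1 \<union> S2 \<union> S3" for p
    using that
  proof (elim UnE)
    assume "p \<in> S1"
    then obtain e where e: "e \<in> edges n" and p: "p = (\<lambda>M. det (M e))"
      unfolding S1_def by auto
    show ?thesis
      unfolding p by (rule exI, rule mhpoly_det, rule mhpoly_coord, rule e)
  next
    assume "p \<in> S2"
    then obtain r i j k where p: "p = (\<lambda>M. cof_form r M k i j k)"
      and "i \<in> {1..n} \<and> j \<in> {1..n} \<and> k \<in> {1..n} \<and> i < j \<and> k \<noteq> i \<and> k \<noteq> j"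
      unfolding S2_def by blast
    then have ijk: "{k, i, j, k} \<subseteq> {1..n}" "k \<noteq> i" "i \<noteq> j" "k \<noteq> j"
      by auto
    show ?thesis
      unfolding p by (rule exI, rule mhpoly_cof_form) (rule ijk)+
  next
    assume "p \<in> S3"
    then obtain r a b c d where p: "p = cof_quad r a b c d"
      and "a \<in> {1..n} \<and> b \<in> {1..n} \<and> c \<in> {1..n} \<and> d \<in> {1..n} \<and> a < b \<and> b < c \<and> c < d"
      unfolding S3_def by blast
    then have "{a, b, c, d} \<subseteq> {1..n}" "distinct [a, b, c, d]"
      by auto
    then show ?thesis
      unfolding p by (rule mhpoly_cof_quad)
  qed
  show "constraint_variety n =
      {x \<in> edges n \<rightarrow>\<^sub>E UNIV. \<forall>p\<in>S1 \<union> S2 \<union> S3. p (\<lambda>e. rep_proj_mat (x e)) = 0}"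
  proof -
    have "(\<forall>p\<in>S1. p M = 0) \<longleftrightarrow> (\<forall>e\<in>edges n. det (M e) = 0)" for M
      unfolding S1_def by auto
    moreover have "(\<forall>p\<in>S2. p M = 0) \<longleftrightarrow>
        (\<forall>r. \<forall>i\<in>{1..n}. \<forall>j\<in>{1..n}. \<forall>k\<in>{1..n}. i < j \<and> k \<noteq> i \<and> k \<noteq> j \<longrightarrow> cof_form r M k i j k = 0)" for M
      by (simp add: S2_def)
    moreover have "(\<forall>p\<in>S3. p M = 0) \<longleftrightarrow>
        (\<forall>r. \<forall>a\<in>{1..n}. \<forall>b\<in>{1..n}. \<forall>c\<in>{1..n}. \<forall>d\<in>{1..n}. a < b \<and> b < c \<and> c < d \<longrightarrow>
          cof_quad r a b c d M = 0)" for M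
      by (simp add: S3_def)
    ultimately show ?thesis
      by (simp only: constraint_variety_eq ball_Un conj_assoc)
  qed
qed

section \<open>The image of the fundamental map\<close>

lemma rep_abs_proj_mat:
  assumes "A \<noteq> 0"
  obtains k where "k \<noteq> 0" "rep_proj_mat (abs_proj_mat A) = k *\<^sub>R A"
proof -
  have "proportional A A"
    unfolding proportional_def using assms by (auto intro: exI[of _ 1])
  then have "proportional (rep_proj_mat (abs_proj_mat A)) A"
    by (rule rep_abs_rsp_left[OF Quotient3_proj_mat])
  then obtain k where "rep_proj_mat (abs_proj_mat A) = k *\<^sub>R A" "rep_proj_mat (abs_proj_mat A) \<noteq> 0"
    unfolding proportional_def by blast
  then show thesis
    using that[of k] by auto
qed

lemma cof3_scaleR: "cof3 (k *\<^sub>R A) = (k * k) *\<^sub>R cof3 A"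
  by (simp add: cof3_def vec_eq_iff cross_mult_left cross_mult_right)

lemma transpose_scaleR: "transpose (k *\<^sub>R A) = k *\<^sub>R transpose A" for A :: "real^'n^'m"
  by (simp add: transpose_def vec_eq_iff)

text \<open>In the expansion along the first row, the cofactors are a multiple of the epipole
  \<open>Q *v center P\<close>. By \<open>psi_mult\<close> this vector lies in the kernel, as
  \<open>P\<close> annihilates its own centre.\<close>

lemma det_psi: "det (psi P Q) = 0"
proof -
  have "cof3 (psi P Q) $ 1 = - ((P *v center Q) $ 1) *\<^sub>R (Q *v center P)"
    by (simp add: vec_eq_iff cof3_psi)
  moreover have "P *v center P = 0"
    by (simp add: vec_eq_iff matrix_vector_mult_nth inner_center forall_3 det4_def algebra_simps)
  then have "psi P Q *v (Q *v center P) = 0"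
    by (simp add: psi_mult)
  ultimately show ?thesis
    by (simp add: det_eq_inner_cof3[of _ 1] matrix_vector_mult_nth[symmetric])
qed

text \<open>On the domain \<open>psi\<close> is nonzero, so passing to the class and back only
  rescales it. For \<open>i > j\<close> the transpose is absorbed by
  \<open>psi_transpose\<close>.\<close>

lemma fmat_fundamental_map:
  assumes "P \<in> fundamental_map_dom n" "i \<in> {1..n}" "j \<in> {1..n}" "i \<noteq> j"
  shows "\<exists>k. fmat (fundamental_map n P) i j = k *\<^sub>R psi (rep_proj_mat (P i)) (rep_proj_mat (P j))"
proof (cases "i < j")
  case True
  then have e: "(i, j) \<in> edges n" using assms by (simp add: edges_def)
  then have "psi (rep_proj_mat (P i)) (rep_proj_mat (P j)) \<noteq> 0"
    using assms(1) by (auto simp: fundamental_map_dom_def)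
  then show ?thesis
    using True e by (auto simp: fmat_def fundamental_map_def elim: rep_abs_proj_mat)
next
  case False
  then have e: "(j, i) \<in> edges n" using assms by (simp add: edges_def)
  then have "psi (rep_proj_mat (P j)) (rep_proj_mat (P i)) \<noteq> 0"
    using assms(1) by (auto simp: fundamental_map_dom_def)
  then obtain k where "rep_proj_mat (abs_proj_mat (psi (rep_proj_mat (P j)) (rep_proj_mat (P i)))) =
      k *\<^sub>R psi (rep_proj_mat (P j)) (rep_proj_mat (P i))"
    by (rule rep_abs_proj_mat)
  then have "fmat (fundamental_map n P) i j = k *\<^sub>R psi (rep_proj_mat (P i)) (rep_proj_mat (P j))"
    using False e by (simp add: fmat_def fundamental_map_def transpose_scaleR psi_transpose)
  then show ?thesis ..
qed

lemma cof3_fundamental_map: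
  assumes "P \<in> fundamental_map_dom n" "i \<in> {1..n}" "j \<in> {1..n}" "i \<noteq> j"
  shows "\<exists>k. cof3 (fmat (fundamental_map n P) i j) $ a =
    k *\<^sub>R (rep_proj_mat (P j) *v center (rep_proj_mat (P i)))"
proof -
  let ?P = "rep_proj_mat (P i)" and ?Q = "rep_proj_mat (P j)"
  obtain k where k: "fmat (fundamental_map n P) i j = k *\<^sub>R psi ?P ?Q"
    using fmat_fundamental_map[OF assms] ..
  have "cof3 (psi ?P ?Q) $ a = (- (?P *v center ?Q) $ a) *\<^sub>R (?Q *v center ?P)"
    by (simp add: vec_eq_iff cof3_psi)
  then have "cof3 (fmat (fundamental_map n P) i j) $ a =
      (k * k * (- (?P *v center ?Q) $ a)) *\<^sub>R (?Q *v center ?P)"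
    by (simp add: k cof3_scaleR)
  then show ?thesis ..
qed

lemma det_fundamental_map:
  assumes "P \<in> fundamental_map_dom n" "i \<in> {1..n}" "j \<in> {1..n}" "i \<noteq> j"
  shows "det (fmat (fundamental_map n P) i j) = 0"
proof -
  let ?F = "psi (rep_proj_mat (P i)) (rep_proj_mat (P j))"
  obtain k where k: "fmat (fundamental_map n P) i j = k *\<^sub>R ?F"
    using fmat_fundamental_map[OF assms] ..
  have "det (k *\<^sub>R ?F) = k ^ 3 * det ?F"
    by (simp add: det_3 power3_eq_cube algebra_simps)
  then show ?thesis
    unfolding k by (simp add: det_psi)
qed

text \<open>The epipole is the image of centre \<open>i\<close> in camera \<open>j\<close>. Going
  through the cofactors includes fundamental matrices of rank one, whose epipole is zero.\<close>

lemma epipole_fundamental_map: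
  assumes "P \<in> fundamental_map_dom n" "i \<in> {1..n}" "j \<in> {1..n}" "i \<noteq> j"
  shows "\<exists>k. epipole (fundamental_map n P) i j =
    k *\<^sub>R (rep_proj_mat (P j) *v center (rep_proj_mat (P i)))"
proof -
  obtain a l where "epipole (fundamental_map n P) i j = l *\<^sub>R cof3 (fmat (fundamental_map n P) i j) $ a"
    using epipole_eq_scale_cof3[OF det_fundamental_map[OF assms]] by blast
  then show ?thesis
    using cof3_fundamental_map[OF assms, of a] by (metis scaleR_scaleR)
qed

text \<open>\<open>psi_mult\<close> turns the product of fundamental matrix and epipole into a cross
  product, and \<open>det_mult_center\<close> turns its pairing with the other epipole into a
  bracket of four centres. The scalars of the epipoles stand apart as
  \<open>quad_constraint_scale\<close> requires.\<close>

lemma epi_form_fundamental_map: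
  assumes "P \<in> fundamental_map_dom n"
  defines "c \<equiv> \<lambda>i. center (rep_proj_mat (P i))"
  obtains k m where "\<And>s i j t. {s, i, j, t} \<subseteq> {1..n} \<Longrightarrow> s \<noteq> i \<Longrightarrow> i \<noteq> j \<Longrightarrow> t \<noteq> j \<Longrightarrow>
    epi_form (fundamental_map n P) s i j t =
      k s i * k t j * (m i j * det4 (c s) (c t) (c j) (c i))"
proof -
  have "\<forall>i j. \<exists>k. i \<in> {1..n} \<longrightarrow> j \<in> {1..n} \<longrightarrow> i \<noteq> j \<longrightarrow>
      epipole (fundamental_map n P) i j = k *\<^sub>R (rep_proj_mat (P j) *v c i)"
    unfolding c_def using epipole_fundamental_map[OF assms(1)] by blast
  then obtain k where k: "\<forall>i j. i \<in> {1..n} \<longrightarrow> j \<in> {1..n} \<longrightarrow> i \<noteq> j \<longrightarrow>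
      epipole (fundamental_map n P) i j = k i j *\<^sub>R (rep_proj_mat (P j) *v c i)"
    by (auto simp only: choice_iff)
  have "\<forall>i j. \<exists>m. i \<in> {1..n} \<longrightarrow> j \<in> {1..n} \<longrightarrow> i \<noteq> j \<longrightarrow>
      fmat (fundamental_map n P) i j = m *\<^sub>R psi (rep_proj_mat (P i)) (rep_proj_mat (P j))"
    using fmat_fundamental_map[OF assms(1)] by blast
  then obtain m where m: "\<forall>i j. i \<in> {1..n} \<longrightarrow> j \<in> {1..n} \<longrightarrow> i \<noteq> j \<longrightarrow>
      fmat (fundamental_map n P) i j = m i j *\<^sub>R psi (rep_proj_mat (P i)) (rep_proj_mat (P j))"
    by (auto simp only: choice_iff)
  show thesis
  proof (rule that)
    fix s i j t
    assume "{s, i, j, t} \<subseteq> {1..n}" "s \<noteq> i" "i \<noteq> j" "t \<noteq> j"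
    then have "epipole (fundamental_map n P) s i = k s i *\<^sub>R (rep_proj_mat (P i) *v c s)"
      "epipole (fundamental_map n P) t j = k t j *\<^sub>R (rep_proj_mat (P j) *v c t)"
      "fmat (fundamental_map n P) i j = m i j *\<^sub>R psi (rep_proj_mat (P i)) (rep_proj_mat (P j))"
      using k m by auto
    then show "epi_form (fundamental_map n P) s i j t =
      k s i * k t j * (m i j * det4 (c s) (c t) (c j) (c i))"
      unfolding epi_form_def
      by (simp add: matrix_vector_mult_scaleR scaleR_matrix_vector_assoc[symmetric] psi_mult c_def
          det_mult_center)
  qed
qed

text \<open>The six brackets on the left are even permutations of \<open>v a, v b, v c, v d\<close>,
  those on the right odd ones, and six signs cancel. Each \<open>m i j\<close> with \<open>i\<close>
  before \<open>j\<close> occurs once on either side.\<close>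

lemma quad_constraint_det4:
  "quad_constraint (\<lambda>s i j t. m i j * det4 (v s) (v t) (v j) (v i)) a b c d"
proof -
  have "det4 (v d) (v c) (v b) (v a) = det4 (v a) (v b) (v c) (v d)"
    "det4 (v b) (v d) (v c) (v a) = det4 (v a) (v b) (v c) (v d)"
    "det4 (v c) (v b) (v d) (v a) = det4 (v a) (v b) (v c) (v d)"
    "det4 (v d) (v a) (v c) (v b) = det4 (v a) (v b) (v c) (v d)"
    "det4 (v a) (v c) (v d) (v b) = det4 (v a) (v b) (v c) (v d)"
    "det4 (v b) (v a) (v d) (v c) = det4 (v a) (v b) (v c) (v d)"
    "det4 (v c) (v d) (v b) (v a) = - det4 (v a) (v b) (v c) (v d)"
    "det4 (v d) (v b) (v c) (v a) = - det4 (v a) (v b) (v c) (v d)"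
    "det4 (v b) (v c) (v d) (v a) = - det4 (v a) (v b) (v c) (v d)"
    "det4 (v a) (v d) (v c) (v b) = - det4 (v a) (v b) (v c) (v d)"
    "det4 (v c) (v a) (v d) (v b) = - det4 (v a) (v b) (v c) (v d)"
    "det4 (v a) (v b) (v d) (v c) = - det4 (v a) (v b) (v c) (v d)"
    unfolding det4_def by algebra+
  then show ?thesis
    unfolding quad_constraint_def by simp
qed

lemma fundamental_map_in_constraint_variety:
  assumes "P \<in> fundamental_map_dom n"
  shows "fundamental_map n P \<in> constraint_variety n"
proof -
  let ?x = "fundamental_map n P" and ?c = "\<lambda>i. center (rep_proj_mat (P i))"
  obtain k m where km: "\<And>s i j t. {s, i, j, t} \<subseteq> {1..n} \<Longrightarrow> s \<noteq> i \<Longrightarrow> i \<noteq> j \<Longrightarrow> t \<noteq> j \<Longrightarrow>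
      epi_form ?x s i j t = k s i * k t j * (m i j * det4 (?c s) (?c t) (?c j) (?c i))"
    using epi_form_fundamental_map[OF assms] by metis
  have "\<forall>(i, j)\<in>edges n. rank (fmat ?x i j) \<le> 2"
    using det_fundamental_map[OF assms] by (auto simp: rank_le_2_iff edges_def)
  moreover have "triple_constraints n ?x"
    unfolding triple_constraints_def
  proof (intro ballI impI)
    fix i j k
    assume "i \<in> {1..n}" "j \<in> {1..n}" "k \<in> {1..n}" "i < j \<and> k \<noteq> i \<and> k \<noteq> j"
    \<comment> \<open>The centre of camera \<open>k\<close> occurs twice in the bracket.\<close>
    then show "epi_form ?x k i j k = 0"
      using km[of k i j k] by (auto simp: det4_def)
  qed
  moreover have "quadruple_constraints n ?x"
    unfolding quadruple_constraints_def quad_constraint_def[symmetric]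
  proof (intro ballI impI)
    fix a b c d
    assume V: "a \<in> {1..n}" "b \<in> {1..n}" "c \<in> {1..n}" "d \<in> {1..n}" and less: "a < b \<and> b < c \<and> c < d"
    show "quad_constraint (epi_form ?x) a b c d"
    proof (rule quad_constraint_scale[OF _ _ quad_constraint_det4])
      show "distinct [a, b, c, d]" using less by auto
      fix s i j t
      assume *: "{s, i, j, t} \<subseteq> {a, b, c, d}" "distinct [s, i, j, t]"
      have "{a, b, c, d} \<subseteq> {1..n}" using V by simp
      with * show "epi_form ?x s i j t = k s i * k t j * (m i j * det4 (?c s) (?c t) (?c j) (?c i))"
        by (intro km) auto
    qed
  qed
  moreover have "?x \<in> edges n \<rightarrow>\<^sub>E UNIV"
    by (auto simp: fundamental_map_def)
  ultimately show ?thesis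
    by (simp add: constraint_variety_def)
qed

section \<open>A point outside the viewing graph variety\<close>

text \<open>One coordinate, for one choice of cofactor rows, of the condition
  \<open>F\<^sup>1\<^sup>2 e_2\<^sup>3 \<times> F\<^sup>1\<^sup>3 e_3\<^sup>2 = 0\<close>.\<close>

definition transfer_form :: "(nat \<times> nat \<Rightarrow> real^3^3) \<Rightarrow> real" where
  "transfer_form M = ((edge_mat M 1 2 *v cof3 (edge_mat M 3 2) $ 3) \<times>
     (edge_mat M 1 3 *v cof3 (edge_mat M 2 3) $ 3)) $ 3"

lemma mhpoly_transfer_form:
  assumes "n \<ge> 3"
  shows "mhpoly (edges n)
    (\<lambda>e. (edge_deg 1 2 e + (edge_deg 3 2 e + edge_deg 3 2 e)) +
      (edge_deg 1 3 e + (edge_deg 2 3 e + edge_deg 2 3 e))) transfer_form"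
  unfolding transfer_form_def[abs_def]
  by (intro mhpoly_cross3 mhpoly_matrix_vector_mult mhpoly_cof3 mhpoly_edge_mat) (use assms in auto)

definition unit_mat :: "3 \<Rightarrow> 3 \<Rightarrow> real^3^3" where
  "unit_mat i j = (\<chi> a b. if a = i \<and> b = j then 1 else 0)"

text \<open>Both epipoles of the rank-two matrix on \<open>(2, 3)\<close> are the third unit vector.
  The matrices on \<open>(1, 2)\<close> and \<open>(1, 3)\<close> send it to the first and the
  second unit vector, which are not parallel.\<close>

definition excess_mat :: "nat \<times> nat \<Rightarrow> real^3^3" where
  "excess_mat e = (if e = (1, 2) then unit_mat 1 3
     else if e = (2, 3) then unit_mat 1 1 + unit_mat 2 2 else unit_mat 2 3)"

lemma excess_mat_nonzero: "excess_mat e \<noteq> 0"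
  by (auto simp: excess_mat_def unit_mat_def vec_eq_iff)

lemma det_excess_mat: "det (k *\<^sub>R excess_mat e) = 0"
  by (auto simp: excess_mat_def unit_mat_def det_3)

lemma cof3_excess_mat:
  assumes "e \<noteq> (2, 3)"
  shows "cof3 (excess_mat e) = 0" "cof3 (transpose (excess_mat e)) = 0"
  using assms
  by (auto simp: excess_mat_def unit_mat_def cof3_def vec_eq_iff forall_3 cross3_nth numeral_mod_3 transpose_def)

lemma transfer_form_excess_mat:
  assumes "M (1, 2) = k *\<^sub>R excess_mat (1, 2)" "M (1, 3) = l *\<^sub>R excess_mat (1, 3)"
    "M (2, 3) = m *\<^sub>R excess_mat (2, 3)"
  shows "transfer_form M = k * l * m ^ 4"
  by (simp add: transfer_form_def edge_mat_def assms excess_mat_def unit_mat_def cof3_def cross3_nth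
      numeral_mod_3 transpose_def matrix_vector_mult_nth inner_vec_def sum_3 power4_eq_xxxx mult_ac del: One_nat_def)

lemma cof3_edge_mat_excess_mat:
  assumes "e = (min i j, max i j)" "e \<noteq> (2, 3)" "M e = k *\<^sub>R excess_mat e"
  shows "cof3 (edge_mat M i j) = 0"
proof (cases "i < j")
  case True
  then have "edge_mat M i j = k *\<^sub>R excess_mat e"
    using assms by (simp add: edge_mat_def min_def max_def)
  then show ?thesis
    using assms(2) by (simp add: cof3_scaleR cof3_excess_mat)
next
  case False
  then have "edge_mat M i j = k *\<^sub>R transpose (excess_mat e)"
    using assms by (simp add: edge_mat_def min_def max_def transpose_scaleR split: if_splits)
  then show ?thesis
    using assms(2) by (simp add: cof3_scaleR cof3_excess_mat)
qed

text \<open>By \<open>psi_mult\<close> the two lines are multiples of \<open>u \<times> v\<close>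
  and \<open>v \<times> u\<close>, where \<open>u\<close> and \<open>v\<close> are the images of
  centres 3 and 2 in camera 1.\<close>

lemma transfer_form_fundamental_map:
  assumes "n \<ge> 3" "P \<in> fundamental_map_dom n"
  shows "transfer_form (\<lambda>e. rep_proj_mat (fundamental_map n P e)) = 0"
proof -
  let ?P = "\<lambda>i. rep_proj_mat (P i)" and ?F = "fmat (fundamental_map n P)"
  have V: "1 \<in> {1..n}" "2 \<in> {1..n}" "3 \<in> {1..n}" using assms(1) by auto
  obtain k where "cof3 (?F 3 2) $ 3 = k *\<^sub>R (?P 2 *v center (?P 3))"
    using cof3_fundamental_map[OF assms(2) V(3,2)] by auto
  moreover obtain k' where "cof3 (?F 2 3) $ 3 = k' *\<^sub>R (?P 3 *v center (?P 2))"
    using cof3_fundamental_map[OF assms(2) V(2,3)] by auto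
  moreover obtain l where "?F 1 2 = l *\<^sub>R psi (?P 1) (?P 2)"
    using fmat_fundamental_map[OF assms(2) V(1,2)] by auto
  moreover obtain l' where "?F 1 3 = l' *\<^sub>R psi (?P 1) (?P 3)"
    using fmat_fundamental_map[OF assms(2) V(1,3)] by auto
  moreover have "(u \<times> v) \<times> (v \<times> u) = 0" for u v :: "real^3"
    by (subst cross_skew[of v u]) simp
  ultimately show ?thesis
    unfolding transfer_form_def fmat_eq[symmetric]
    by (simp add: matrix_vector_mult_scaleR scaleR_matrix_vector_assoc[symmetric] psi_mult
        cross_mult_left cross_mult_right)
qed

section \<open>Containment and separation\<close>

lemma viewing_graph_variety_subset: "viewing_graph_variety n \<subseteq> constraint_variety n"
  unfolding viewing_graph_variety_def zariski_closure_def
  by (rule Inter_lower)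
    (auto intro: zariski_closed_constraint_variety fundamental_map_in_constraint_variety)

text \<open>The zero set of \<open>transfer_form\<close> is closed and contains the image, hence
  also its closure.\<close>

lemma transfer_form_viewing_graph_variety:
  assumes "n \<ge> 3" "x \<in> viewing_graph_variety n"
  shows "transfer_form (\<lambda>e. rep_proj_mat (x e)) = 0"
proof -
  let ?Z = "{x \<in> edges n \<rightarrow>\<^sub>E UNIV. \<forall>p\<in>{transfer_form}. p (\<lambda>e. rep_proj_mat (x e)) = 0}"
  have "zariski_closed (edges n) ?Z"
  proof (rule zariski_closedI[OF _ refl])
    fix p assume "p \<in> {transfer_form}"
    then show "\<exists>d. mhpoly (edges n) d p"
      using mhpoly_transfer_form[OF assms(1)] by (intro exI) simp
  qed
  moreover have "fundamental_map n ` fundamental_map_dom n \<subseteq> ?Z"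
    using transfer_form_fundamental_map[OF assms(1)] by (auto simp: fundamental_map_def)
  ultimately have "viewing_graph_variety n \<subseteq> ?Z"
    unfolding viewing_graph_variety_def zariski_closure_def by (intro Inter_lower) simp
  then show ?thesis
    using assms(2) by auto
qed

lemma ex_excess_point:
  assumes "n \<ge> 3"
  shows "\<exists>x\<in>constraint_variety n. transfer_form (\<lambda>e. rep_proj_mat (x e)) \<noteq> 0"
proof -
  define x where "x = (\<lambda>e\<in>edges n. abs_proj_mat (excess_mat e))"
  let ?M = "\<lambda>e. rep_proj_mat (x e)"
  have "\<forall>e. \<exists>k. e \<in> edges n \<longrightarrow> k \<noteq> 0 \<and> ?M e = k *\<^sub>R excess_mat e"
    by (auto simp: x_def intro: rep_abs_proj_mat[OF excess_mat_nonzero])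
  then obtain k where k: "\<And>e. e \<in> edges n \<Longrightarrow> k e \<noteq> 0 \<and> ?M e = k e *\<^sub>R excess_mat e"
    by (auto simp only: choice_iff)
  have cof: "cof3 (edge_mat ?M i j) = 0"
    if "i \<in> {1..n}" "j \<in> {1..n}" "i \<noteq> j" "(min i j, max i j) \<noteq> (2, 3)" for i j
  proof (rule cof3_edge_mat_excess_mat[OF refl that(4)])
    show "?M (min i j, max i j) = k (min i j, max i j) *\<^sub>R excess_mat (min i j, max i j)"
      using that k by (auto simp: edges_def min_def max_def)
  qed
  have "cof_form r ?M s i j s = 0"
    if "i \<in> {1..n}" "j \<in> {1..n}" "s \<in> {1..n}" "i < j \<and> s \<noteq> i \<and> s \<noteq> j" for r s i j
  proof -
    \<comment> \<open>The edges joining \<open>s\<close> to \<open>i\<close> and to \<open>j\<close>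
      differ, so at least one has rank one and its cofactor row vanishes.\<close>
    have "(min s i, max s i) \<noteq> (2, 3) \<or> (min s j, max s j) \<noteq> (2, 3)"
      using that(4) by (auto simp: min_def max_def)
    then show ?thesis
      using cof[of s i] cof[of s j] that by (auto simp: cof_form_def)
  qed
  moreover have "cof_quad r a b c d ?M = 0"
    if "a \<in> {1..n}" "b \<in> {1..n}" "c \<in> {1..n}" "d \<in> {1..n}" "a < b \<and> b < c \<and> c < d" for r a b c d
  proof -
    \<comment> \<open>As \<open>b\<close> and \<open>c\<close> lie strictly between \<open>a\<close>
      and \<open>d\<close>, the edge is not \<open>(2, 3)\<close>; its cofactors enter both sides of
      the constraint.\<close>
    have "cof3 (edge_mat ?M d a) = 0"
      using that by (intro cof) auto
    then show ?thesis
      by (simp add: cof_quad_def cof_form_def)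
  qed
  moreover have "det (?M e) = 0" if "e \<in> edges n" for e
    using k[OF that] det_excess_mat by metis
  ultimately have "x \<in> constraint_variety n"
    unfolding constraint_variety_eq by (auto simp: x_def)
  moreover have "transfer_form ?M \<noteq> 0"
  proof -
    have "(1, 2) \<in> edges n" "(1, 3) \<in> edges n" "(2, 3) \<in> edges n"
      using assms by (auto simp: edges_def)
    with k show ?thesis
      using transfer_form_excess_mat[of ?M "k (1, 2)" "k (1, 3)" "k (2, 3)"] by simp
  qed
  ultimately show ?thesis by blast
qed

theorem proposition5p1:
  fixes n :: nat
  assumes "n \<ge> 3"
  shows "zariski_closed (edges n) (constraint_variety n) \<and>
         viewing_graph_variety n \<subset> constraint_variety n"
  using zariski_closed_constraint_variety viewing_graph_variety_subset
    ex_excess_point[OF assms] transfer_form_viewing_graph_variety[OF assms]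
  by blast

end
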